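(* Let $D$ be an FBD-graph. Then there exists a finite simple oriented graph $D'$ which does not admit a sequence of edge-flips monotonically decreasing the number of directed 3-cycles to zero; that is, there is no finite sequence of graphs $D'=G_0,G_1,\dots,G_k$ ($k\ge 0$) such that each $G_{i+1}$ is obtained from $G_i$ by a single edge-flip, the number of directed 3-cycles of $G_{i+1}$ is at most that of $G_i$ for all $0\le i<k$, and $G_k$ has no directed 3-cycles.
   Context: A finite simple oriented graph is a pair $G=(V,E)$ with $V$ a finite set and $E\subseteq\{(i,j)\in V\times V : i\neq j\}$ such that $(i,j)\in E$ implies $(j,i)\notin E$. Vertices $a,b,c\in V$ form a (directed) 3-cycle iff $(a,b),(b,c),(c,a)\in E$; 3-cycles are counted up to cyclic rotation. An edge-flip of an edge $(i,j)\in E$ replaces the edge $(i,j)$ by $(j,i)$ and leaves all other edges unchanged. "Monotonically decreasing" means that the number never increases along the sequence. An edge $(a,b)\in E$ is blocked iff there is a vertex $c\in V$ with $(a,c),(c,b)\in E$. A graph is fully blocked iff all of its edges are blocked. An FBD-graph is a fully blocked, finite, non-empty (i.e. having at least one edge) simple oriented graph without directed 3-cycles. *)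

theory Defs
  imports "Graph_Theory.Pair_Digraph"
begin

locale oriented_graph = pair_digraph G for G :: "'a pair_pre_digraph" +
  assumes asym_arcs: "asym (parcs G)"

definition is_3cycle :: "'a pair_pre_digraph \<Rightarrow> 'a \<Rightarrow> 'a \<Rightarrow> 'a \<Rightarrow> bool" where
  "is_3cycle G a b c \<longleftrightarrow> (a, b) \<in> parcs G \<and> (b, c) \<in> parcs G \<and> (c, a) \<in> parcs G"

text \<open>A 3-cycle up to rotation is represented by its set of three edges; the lemma
  \<open>cycle_edges_eq_iff\<close> below shows that this identifies exactly the rotations of a triple.\<close>

definition directed_3cycles :: "'a pair_pre_digraph \<Rightarrow> 'a rel set" where
  "directed_3cycles G = {{(a, b), (b, c), (c, a)} | a b c. is_3cycle G a b c}"

definition num_3cycles :: "'a pair_pre_digraph \<Rightarrow> nat" where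
  "num_3cycles G = card (directed_3cycles G)"

definition edge_flip :: "'a pair_pre_digraph \<Rightarrow> 'a pair_pre_digraph \<Rightarrow> bool" where
  "edge_flip G H \<longleftrightarrow>
     (\<exists>i j. (i, j) \<in> parcs G \<and> H = G\<lparr>parcs := insert (j, i) (parcs G - {(i, j)})\<rparr>)"

definition blocked :: "'a pair_pre_digraph \<Rightarrow> 'a \<times> 'a \<Rightarrow> bool" where
  "blocked G e \<longleftrightarrow> (\<exists>c\<in>pverts G. (fst e, c) \<in> parcs G \<and> (c, snd e) \<in> parcs G)"

definition fully_blocked :: "'a pair_pre_digraph \<Rightarrow> bool" where
  "fully_blocked G \<longleftrightarrow> (\<forall>e\<in>parcs G. blocked G e)"

locale FBD_graph = oriented_graph G for G :: "'a pair_pre_digraph" +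
  assumes fully_blocked: "fully_blocked G"
    and nonempty_arcs: "parcs G \<noteq> {}"
    and no_3cycles: "directed_3cycles G = {}"

lemma (in oriented_graph) cycle_edges_eq_iff:
  assumes "is_3cycle G a b c" "is_3cycle G a' b' c'"
  shows "{(a, b), (b, c), (c, a)} = {(a', b'), (b', c'), (c', a')} \<longleftrightarrow>
    (a', b', c') \<in> {(a, b, c), (b, c, a), (c, a, b)}" (is "?E = ?E' \<longleftrightarrow> ?R")
proof
  have dist: "a \<noteq> b" "b \<noteq> c" "c \<noteq> a"
    using assms(1) pair_no_loops[of "(a, b)"] pair_no_loops[of "(b, c)"]
      pair_no_loops[of "(c, a)"] by (simp_all add: is_3cycle_def)
  assume "?E = ?E'"
  then have "(a', b') \<in> ?E" "(b', c') \<in> ?E" by simp_all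
  then show ?R using dist by (elim insertE emptyE) simp_all
next
  assume ?R
  then show "?E = ?E'" by (elim insertE emptyE) (simp_all add: insert_commute)
qed

lemma oriented_graph_edge_flip:
  assumes "oriented_graph G" "edge_flip G H"
  shows "oriented_graph H"
proof -
  interpret oriented_graph G by fact
  obtain i j where ij: "(i, j) \<in> parcs G"
    and H: "H = G\<lparr>parcs := insert (j, i) (parcs G - {(i, j)})\<rparr>"
    using assms(2) unfolding edge_flip_def by blast
  have ne: "i \<noteq> j" using pair_no_loops[OF ij] by simp
  have arcs: "e \<in> parcs G \<or> e = (j, i)" if "e \<in> parcs H" for e using that H by auto
  show ?thesis
  proof unfold_locales
    show "asym (parcs H)"
      using asymD[OF asym_arcs] ne by (intro asymI) (fastforce simp: H)
  qed (use arcs ij ne in_arcsD1[OF ij] in_arcsD2[OF ij] arc_fst_in_verts arc_snd_in_verts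
         pair_no_loops pair_finite_verts pair_finite_arcs in \<open>force simp: H\<close>)+
qed

end

theory Submission
  imports Defs
begin

text \<open>
  Flipping an edge \<open>(a, b)\<close> destroys the 3-cycles through \<open>(a, b)\<close>, one for each 2-path from
  \<open>b\<close> to \<open>a\<close>, and creates one 3-cycle for each 2-path from \<open>a\<close> to \<open>b\<close>
  (\<open>edge_flip_balance\<close>). Hence a graph in which every edge has more 2-paths running along it
  than against it (\<open>flip_increasing\<close>) admits no first move, and it suffices to find such a graph
  that contains a 3-cycle.

  Start from a single 3-cycle of hubs. To make its edges too expensive to flip, each hub edge
  \<open>(x, y)\<close> gets a private copy of a piece of \<open>D\<close>, with edges from \<open>x\<close> to every vertex of the
  copy and from every vertex of the copy to \<open>y\<close>. A piece with at least two vertices outweighs the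
  one 3-cycle that the flip destroys. No new edge lies on a 3-cycle, so it only has to be blocked.
  The edges inside the copy are blocked because \<open>D\<close> is fully blocked. The edges between a
  copy and its two hubs are blocked if every vertex of the piece has a predecessor and a
  successor inside the piece.

  The whole of \<open>D\<close> may fail the last condition, as it may have sources and sinks. Its interior,
  the set of vertices that are neither, satisfies it: the vertex that blocks an edge has an
  incoming and an outgoing edge, so every edge of \<open>D\<close> is blocked by an interior vertex.
\<close>

section \<open>The effect of an edge-flip on the number of 3-cycles\<close>

definition two_paths :: "'a pair_pre_digraph \<Rightarrow> 'a \<Rightarrow> 'a \<Rightarrow> 'a set" where
  "two_paths G a b = {c. (a, c) \<in> parcs G \<and> (c, b) \<in> parcs G}"

lemma directed_3cycles_iff:
  "C \<in> directed_3cycles G \<longleftrightarrow>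
     C \<subseteq> parcs G \<and> (\<exists>a b c. C = {(a, b), (b, c), (c, a)})"
  by (auto simp: directed_3cycles_def is_3cycle_def)

lemma (in oriented_graph) finite_two_paths: "finite (two_paths G a b)"
  by (rule finite_subset[OF _ finite_imageI[OF pair_finite_arcs, of snd]])
    (force simp: two_paths_def)

lemma (in oriented_graph) finite_directed_3cycles: "finite (directed_3cycles G)"
proof (rule finite_subset)
  show "directed_3cycles G \<subseteq> Pow (parcs G)"
    by (auto simp: directed_3cycles_iff)
qed simp

lemma (in oriented_graph) card_3cycles_through_arc:
  assumes "(a, b) \<in> parcs G"
  shows "card {C \<in> directed_3cycles G. (a, b) \<in> C} = card (two_paths G b a)"
proof -
  have ne: "a \<noteq> b" using pair_no_loops[OF assms] by simp
  have "{C \<in> directed_3cycles G. (a, b) \<in> C} =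
    (\<lambda>c. {(a, b), (b, c), (c, a)}) ` two_paths G b a" (is "?L = ?R")
  proof
    show "?L \<subseteq> ?R"
    proof
      fix C assume "C \<in> ?L"
      then obtain x y z where C: "C = {(x, y), (y, z), (z, x)}" "is_3cycle G x y z"
        and ab: "(a, b) \<in> C"
        unfolding directed_3cycles_def by blast
      from ab[unfolded C(1)] consider "(a, b) = (x, y)" | "(a, b) = (y, z)" | "(a, b) = (z, x)"
        by blast
      then obtain c where "C = {(a, b), (b, c), (c, a)}" "c \<in> two_paths G b a"
      proof cases
        case 1
        show thesis by (rule that[of z]) (use 1 C in \<open>simp_all add: is_3cycle_def two_paths_def\<close>)
      next
        case 2
        show thesis
          by (rule that[of x]) (use 2 C in \<open>simp_all add: is_3cycle_def two_paths_def insert_commute\<close>)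
      next
        case 3
        show thesis
          by (rule that[of y]) (use 3 C in \<open>simp_all add: is_3cycle_def two_paths_def insert_commute\<close>)
      qed
      then show "C \<in> ?R" by blast
    qed
    show "?R \<subseteq> ?L"
      using assms by (auto simp: directed_3cycles_def is_3cycle_def two_paths_def)
  qed
  moreover have "inj_on (\<lambda>c. {(a, b), (b, c), (c, a)}) (two_paths G b a)"
  proof (rule inj_onI)
    fix c d
    assume cd: "c \<in> two_paths G b a" "d \<in> two_paths G b a"
      and eq: "{(a, b), (b, c), (c, a)} = {(a, b), (b, d), (d, a)}"
    from eq have "(b, c) \<in> {(a, b), (b, d), (d, a)}" by blast
    moreover have "d \<noteq> b" using cd pair_no_loops[of "(b, d)"] by (auto simp: two_paths_def)
    ultimately show "c = d" using ne by simp
  qed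
  ultimately show ?thesis by (simp add: card_image)
qed

text \<open>
  The 3-cycles that avoid the flipped edge are the same before and after. Those that use it
  are counted by 2-paths, and the flip affects no 2-path between its ends.
\<close>

lemma edge_flip_balance:
  assumes "oriented_graph G" and ab: "(a, b) \<in> parcs G"
    and H: "H = G\<lparr>parcs := insert (b, a) (parcs G - {(a, b)})\<rparr>"
  shows "num_3cycles H + card (two_paths G b a) = num_3cycles G + card (two_paths G a b)"
proof -
  interpret G: oriented_graph G by fact
  interpret H: oriented_graph H
    using oriented_graph_edge_flip[OF assms(1)] ab H unfolding edge_flip_def by blast
  have ne: "a \<noteq> b" using G.pair_no_loops[OF ab] by simp
  have ba: "(b, a) \<notin> parcs G" using asymD[OF G.asym_arcs ab] .
  have split: "card (directed_3cycles K) =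
      card {C \<in> directed_3cycles K. e \<in> C} + card {C \<in> directed_3cycles K. e \<notin> C}"
    if "finite (directed_3cycles K)" for K :: "'a pair_pre_digraph" and e
    using that by (subst card_Un_disjoint[symmetric]) (auto intro!: arg_cong[of _ _ card])
  have "{C \<in> directed_3cycles H. (b, a) \<notin> C} = {C \<in> directed_3cycles G. (a, b) \<notin> C}"
  proof -
    have "parcs H - {(b, a)} = parcs G - {(a, b)}" using ba by (auto simp: H)
    moreover have "C \<in> directed_3cycles K \<and> e \<notin> C \<longleftrightarrow>
        C \<subseteq> parcs K - {e} \<and> (\<exists>a b c. C = {(a, b), (b, c), (c, a)})"
      for C e and K :: "'a pair_pre_digraph"
      unfolding directed_3cycles_iff by blast
    ultimately show ?thesis by simp
  qed
  moreover have "two_paths H a b = two_paths G a b"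
  proof -
    have "(c, c) \<notin> parcs G" for c using G.pair_no_loops[of "(c, c)"] by auto
    with ne show ?thesis unfolding two_paths_def H by auto
  qed
  moreover have "(b, a) \<in> parcs H" by (simp add: H)
  ultimately show ?thesis
    using split[OF G.finite_directed_3cycles, of "(a, b)"]
      split[OF H.finite_directed_3cycles, of "(b, a)"]
      G.card_3cycles_through_arc[OF ab] H.card_3cycles_through_arc
    by (simp add: num_3cycles_def)
qed

definition flip_increasing :: "'a pair_pre_digraph \<Rightarrow> bool" where
  "flip_increasing G \<longleftrightarrow>
     (\<forall>(a, b) \<in> parcs G. card (two_paths G b a) < card (two_paths G a b))"

lemma flip_increasing_num_3cycles:
  assumes "oriented_graph G" "flip_increasing G" "edge_flip G H"
  shows "num_3cycles G < num_3cycles H"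
proof -
  obtain a b where ab: "(a, b) \<in> parcs G"
    and H: "H = G\<lparr>parcs := insert (b, a) (parcs G - {(a, b)})\<rparr>"
    using assms(3) unfolding edge_flip_def by blast
  have "card (two_paths G b a) < card (two_paths G a b)"
    using assms(2) ab by (auto simp: flip_increasing_def)
  with edge_flip_balance[OF assms(1) ab H] show ?thesis by linarith
qed

section \<open>Renaming the vertices\<close>

text \<open>
  The construction below uses tagged copies of the vertices of \<open>D\<close>. To move it to the natural
  numbers, the relevant properties must survive a renaming that is injective on the vertices.
\<close>

definition rename_graph :: "('a \<Rightarrow> 'b) \<Rightarrow> 'a pair_pre_digraph \<Rightarrow> 'b pair_pre_digraph" where
  "rename_graph f G = \<lparr>pverts = f ` pverts G, parcs = map_prod f f ` parcs G\<rparr>"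

lemma rename_arcE:
  assumes "(x, y) \<in> parcs (rename_graph f G)"
  obtains u v where "x = f u" "y = f v" "(u, v) \<in> parcs G"
  using assms by (auto simp: rename_graph_def)

lemma (in oriented_graph) rename_arc_iff:
  assumes "inj_on f (pverts G)" "u \<in> pverts G" "v \<in> pverts G"
  shows "(f u, f v) \<in> parcs (rename_graph f G) \<longleftrightarrow> (u, v) \<in> parcs G"
proof
  assume "(f u, f v) \<in> parcs (rename_graph f G)"
  then obtain x y where xy: "f u = f x" "f v = f y" "(x, y) \<in> parcs G" by (rule rename_arcE)
  then have "u = x" "v = y"
    using inj_onD[OF assms(1)] assms(2,3) in_arcsD1 in_arcsD2 by blast+
  with xy(3) show "(u, v) \<in> parcs G" by simp
qed (auto simp: rename_graph_def)

lemma (in oriented_graph) oriented_graph_rename: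
  assumes inj: "inj_on f (pverts G)"
  shows "oriented_graph (rename_graph f G)"
proof unfold_locales
  show "asym (parcs (rename_graph f G))"
  proof (rule asymI)
    fix x y assume "(x, y) \<in> parcs (rename_graph f G)"
    then obtain u v where "x = f u" "y = f v" "(u, v) \<in> parcs G" by (rule rename_arcE)
    then show "(y, x) \<notin> parcs (rename_graph f G)"
      using rename_arc_iff[OF inj] in_arcsD1 in_arcsD2 asymD[OF asym_arcs] by blast
  qed
next
  fix e assume e: "e \<in> parcs (rename_graph f G)"
  then obtain u v where uv: "e = (f u, f v)" "(u, v) \<in> parcs G"
    by (auto simp: rename_graph_def)
  then have "u \<in> pverts G" "v \<in> pverts G" "u \<noteq> v"
    using in_arcsD1 in_arcsD2 pair_no_loops by fastforce+
  then show "fst e \<in> pverts (rename_graph f G)" "snd e \<in> pverts (rename_graph f G)"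
    "fst e \<noteq> snd e"
    using inj uv(1) by (auto simp: rename_graph_def dest: inj_onD)
qed (simp_all add: rename_graph_def)

lemma (in oriented_graph) card_two_paths_rename:
  assumes inj: "inj_on f (pverts G)" and uv: "u \<in> pverts G" "v \<in> pverts G"
  shows "card (two_paths (rename_graph f G) (f u) (f v)) = card (two_paths G u v)"
proof -
  have "two_paths (rename_graph f G) (f u) (f v) = f ` two_paths G u v" (is "?L = ?R")
  proof
    show "?L \<subseteq> ?R"
    proof
      fix x assume x: "x \<in> ?L"
      then obtain c where c: "x = f c" "c \<in> pverts G"
        by (auto simp: two_paths_def elim!: rename_arcE intro: in_arcsD2)
      with x show "x \<in> ?R"
        using rename_arc_iff[OF inj] uv by (auto simp: two_paths_def)
    qed
    show "?R \<subseteq> ?L"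
      by (auto simp: two_paths_def rename_graph_def)
  qed
  moreover have "two_paths G u v \<subseteq> pverts G"
    using in_arcsD1 by (auto simp: two_paths_def)
  ultimately show ?thesis
    using card_image[OF inj_on_subset[OF inj]] by simp
qed

lemma (in oriented_graph) flip_increasing_rename:
  assumes "inj_on f (pverts G)" "flip_increasing G"
  shows "flip_increasing (rename_graph f G)"
  unfolding flip_increasing_def
proof clarify
  fix x y assume "(x, y) \<in> parcs (rename_graph f G)"
  then obtain u v where uv: "x = f u" "y = f v" "(u, v) \<in> parcs G" by (rule rename_arcE)
  with assms(2) have "card (two_paths G v u) < card (two_paths G u v)"
    by (auto simp: flip_increasing_def)
  then show "card (two_paths (rename_graph f G) y x) < card (two_paths (rename_graph f G) x y)"
    using uv card_two_paths_rename[OF assms(1)] in_arcsD1 in_arcsD2 by metis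
qed

lemma directed_3cycles_rename:
  assumes "directed_3cycles G \<noteq> {}"
  shows "directed_3cycles (rename_graph f G) \<noteq> {}"
proof -
  obtain a b c where "is_3cycle G a b c"
    using assms by (auto simp: directed_3cycles_def)
  then have "is_3cycle (rename_graph f G) (f a) (f b) (f c)"
    by (auto simp: is_3cycle_def rename_graph_def)
  then show ?thesis by (auto simp: directed_3cycles_def)
qed

section \<open>The interior of a fully blocked graph\<close>

definition interior_verts :: "'a pair_pre_digraph \<Rightarrow> 'a set" where
  "interior_verts D = {v. (\<exists>a. (a, v) \<in> parcs D) \<and> (\<exists>b. (v, b) \<in> parcs D)}"

context FBD_graph
begin

lemma finite_interior: "finite (interior_verts G)"
  by (rule finite_subset[OF _ pair_finite_verts])
    (auto simp: interior_verts_def intro: in_arcsD1)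

text \<open>
  The vertex \<open>c\<close> that blocks \<open>(a, b)\<close> is interior because \<open>(a, c)\<close> enters it and \<open>(c, b)\<close>
  leaves it. So passing to the interior loses no blocking.
\<close>

lemma blocked_by_interior:
  assumes "(a, b) \<in> parcs G"
  obtains c where "c \<in> interior_verts G" "(a, c) \<in> parcs G" "(c, b) \<in> parcs G"
  using assms fully_blocked
  by (fastforce simp: fully_blocked_def blocked_def interior_verts_def)

lemma interior_predecessor:
  assumes "v \<in> interior_verts G"
  obtains c where "c \<in> interior_verts G" "(c, v) \<in> parcs G"
proof -
  obtain a where "(a, v) \<in> parcs G" using assms by (auto simp: interior_verts_def)
  then show thesis by (rule blocked_by_interior) (rule that)
qed

lemma interior_successor:
  assumes "v \<in> interior_verts G"
  obtains c where "c \<in> interior_verts G" "(v, c) \<in> parcs G"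
proof -
  obtain a where "(v, a) \<in> parcs G" using assms by (auto simp: interior_verts_def)
  then show thesis by (rule blocked_by_interior) (rule that)
qed

lemma card_interior: "2 \<le> card (interior_verts G)"
proof -
  obtain a b where "(a, b) \<in> parcs G" using nonempty_arcs by fastforce
  then obtain v where v: "v \<in> interior_verts G" by (rule blocked_by_interior)
  then obtain c where c: "c \<in> interior_verts G" "(c, v) \<in> parcs G"
    by (rule interior_predecessor)
  then have "c \<noteq> v" using pair_no_loops by fastforce
  then have "card {c, v} = 2" by simp
  then show ?thesis
    using v c card_mono[OF finite_interior, of "{c, v}"] by simp
qed

lemma no_3cycle: "(a, b) \<in> parcs G \<Longrightarrow> (b, c) \<in> parcs G \<Longrightarrow> (c, a) \<notin> parcs G"
  using no_3cycles unfolding directed_3cycles_def is_3cycle_def by blast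

end

section \<open>A 3-cycle reinforced by three copies of the interior\<close>

datatype corner = X | Y | Z

fun nxt :: "corner \<Rightarrow> corner" where
  "nxt X = Y" | "nxt Y = Z" | "nxt Z = X"

lemma nxt_ne [simp]: "nxt i \<noteq> i" "i \<noteq> nxt i" "nxt (nxt i) \<noteq> i" "i \<noteq> nxt (nxt i)"
  by (cases i; simp)+

lemma nxt_nxt_nxt [simp]: "nxt (nxt (nxt i)) = i"
  by (cases i) simp_all

lemma nxt_eq_iff: "i = nxt j \<longleftrightarrow> j = nxt (nxt i)"
  by (cases i; cases j) simp_all

lemma finite_corner: "finite (UNIV :: corner set)"
proof -
  have "(UNIV :: corner set) \<subseteq> {X, Y, Z}" using corner.exhaust by blast
  then show ?thesis by (rule finite_subset) simp
qed

datatype 'a vertex = Hub corner | Copy corner 'a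

text \<open>The copy with index \<open>i\<close> reinforces the hub edge from \<open>Hub i\<close> to \<open>Hub (nxt i)\<close>.\<close>

fun joined :: "'a pair_pre_digraph \<Rightarrow> 'a vertex \<Rightarrow> 'a vertex \<Rightarrow> bool" where
  "joined D (Hub i) (Hub j) \<longleftrightarrow> j = nxt i"
| "joined D (Hub i) (Copy j w) \<longleftrightarrow> j = i \<and> w \<in> interior_verts D"
| "joined D (Copy i v) (Hub j) \<longleftrightarrow> j = nxt i \<and> v \<in> interior_verts D"
| "joined D (Copy i v) (Copy j w) \<longleftrightarrow>
     j = i \<and> v \<in> interior_verts D \<and> w \<in> interior_verts D \<and> (v, w) \<in> parcs D"

definition reinforced_cycle :: "'a pair_pre_digraph \<Rightarrow> 'a vertex pair_pre_digraph" where
  "reinforced_cycle D =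
     \<lparr>pverts = range Hub \<union> (\<Union>i. Copy i ` interior_verts D), parcs = {(u, v). joined D u v}\<rparr>"

lemma reinforced_cycle_simps [simp]:
  "(u, v) \<in> parcs (reinforced_cycle D) \<longleftrightarrow> joined D u v"
  "c \<in> two_paths (reinforced_cycle D) u v \<longleftrightarrow> joined D u c \<and> joined D c v"
  by (simp_all add: reinforced_cycle_def two_paths_def)

lemma directed_3cycles_reinforced_cycle: "directed_3cycles (reinforced_cycle D) \<noteq> {}"
proof -
  have "is_3cycle (reinforced_cycle D) (Hub X) (Hub Y) (Hub Z)"
    by (simp add: is_3cycle_def)
  then show ?thesis by (auto simp: directed_3cycles_def)
qed

context FBD_graph
begin

lemma oriented_graph_reinforced_cycle: "oriented_graph (reinforced_cycle G)"
proof -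
  have verts: "u \<in> pverts (reinforced_cycle G) \<and> v \<in> pverts (reinforced_cycle G)"
    if "joined G u v" for u v
    using that by (cases u; cases v) (auto simp: reinforced_cycle_def)
  have asym: "\<not> joined G v u" if "joined G u v" for u v
    using that asymD[OF asym_arcs] by (cases u; cases v) (auto simp: nxt_eq_iff)
  have irrefl: "\<not> joined G u u" for u using asym by blast
  have fin: "finite (pverts (reinforced_cycle G))"
    using finite_corner finite_interior by (auto simp: reinforced_cycle_def)
  have "parcs (reinforced_cycle G) \<subseteq>
      pverts (reinforced_cycle G) \<times> pverts (reinforced_cycle G)"
    using verts by auto
  then have "finite (parcs (reinforced_cycle G))"
    by (rule finite_subset) (simp add: fin)
  with fin show ?thesis
    using verts asym irrefl by unfold_locales (auto simp: asym_iff)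
qed

lemma flip_increasing_reinforced_cycle: "flip_increasing (reinforced_cycle G)"
proof -
  interpret R: oriented_graph "reinforced_cycle G"
    by (rule oriented_graph_reinforced_cycle)
  let ?P = "two_paths (reinforced_cycle G)"
  have less: "card (?P v u) < card (?P u v)"
    if "\<And>c. joined G v c \<Longrightarrow> \<not> joined G c u" "joined G u c" "joined G c v" for u v c
  proof -
    have "?P v u = {}" using that(1) by auto
    moreover have "c \<in> ?P u v" using that(2,3) by simp
    ultimately show ?thesis
      using R.finite_two_paths by (metis card.empty card_gt_0_iff empty_iff)
  qed
  have "card (?P v u) < card (?P u v)" if uv: "joined G u v" for u v
  proof (cases u)
    case u: (Hub i)
    show ?thesis
    proof (cases v)
      case v: (Hub j)
      \<comment> \<open>The flip destroys the hub 3-cycle alone and creates one 3-cycle per vertex of the copy.\<close>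
      have "c = Hub (nxt (nxt i))" if "c \<in> ?P v u" for c
        using that uv u v by (cases c) auto
      then have "?P v u \<subseteq> {Hub (nxt (nxt i))}" by blast
      from card_mono[OF _ this] have "card (?P v u) \<le> 1" by simp
      moreover have "Copy i ` interior_verts G \<subseteq> ?P u v" using uv u v by auto
      from card_mono[OF R.finite_two_paths this]
      have "card (interior_verts G) \<le> card (?P u v)"
        by (simp add: card_image inj_on_def)
      ultimately show ?thesis using card_interior by linarith
    next
      case v: (Copy j w)
      with uv u obtain c where "c \<in> interior_verts G" "(c, w) \<in> parcs G"
        using interior_predecessor by auto
      moreover have "\<not> joined G c u" if "joined G v c" for c
        using that uv u v by (cases c) auto
      ultimately show ?thesis
        using uv u v by (intro less[of v u "Copy i c"]) auto
    qed
  next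
    case u: (Copy i a)
    show ?thesis
    proof (cases v)
      case v: (Hub j)
      with uv u obtain c where "c \<in> interior_verts G" "(a, c) \<in> parcs G"
        using interior_successor by auto
      moreover have "\<not> joined G c u" if "joined G v c" for c
        using that uv u v by (cases c) auto
      ultimately show ?thesis
        using uv u v by (intro less[of v u "Copy i c"]) auto
    next
      case v: (Copy j b)
      with uv u obtain c where "c \<in> interior_verts G" "(a, c) \<in> parcs G" "(c, b) \<in> parcs G"
        using blocked_by_interior by auto
      moreover have "\<not> joined G c u" if "joined G v c" for c
        using that uv u v no_3cycle by (cases c) auto
      ultimately show ?thesis
        using uv u v by (intro less[of v u "Copy i c"]) auto
    qed
  qed
  then show ?thesis by (auto simp: flip_increasing_def)
qed

end

theorem theorem1:
  fixes D :: "'a pair_pre_digraph"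
  assumes "FBD_graph D"
  shows "\<exists>D' :: nat pair_pre_digraph. oriented_graph D' \<and>
    \<not> (\<exists>(G :: nat \<Rightarrow> nat pair_pre_digraph) (k :: nat).
          G 0 = D' \<and>
          (\<forall>i<k. edge_flip (G i) (G (Suc i)) \<and>
                 num_3cycles (G (Suc i)) \<le> num_3cycles (G i)) \<and>
          directed_3cycles (G k) = {})"
proof -
  interpret FBD_graph D by fact
  interpret R: oriented_graph "reinforced_cycle D"
    by (rule oriented_graph_reinforced_cycle)
  obtain f :: "'a vertex \<Rightarrow> nat" where inj: "inj_on f (pverts (reinforced_cycle D))"
    using finite_imp_inj_to_nat_seg[OF R.pair_finite_verts] by blast
  let ?D' = "rename_graph f (reinforced_cycle D)"
  have orient: "oriented_graph ?D'" by (rule R.oriented_graph_rename[OF inj])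
  moreover have "\<not> (G 0 = ?D' \<and> (\<forall>i<k. edge_flip (G i) (G (Suc i)) \<and>
      num_3cycles (G (Suc i)) \<le> num_3cycles (G i)) \<and> directed_3cycles (G k) = {})" for G k
  proof (cases k)
    case 0
    then show ?thesis
      using directed_3cycles_rename[OF directed_3cycles_reinforced_cycle] by auto
  next
    case (Suc m)
    have "num_3cycles ?D' < num_3cycles H" if "edge_flip ?D' H" for H
      using flip_increasing_num_3cycles[OF orient _ that]
        R.flip_increasing_rename[OF inj flip_increasing_reinforced_cycle] .
    with Suc show ?thesis by (metis not_less zero_less_Suc)
  qed
  ultimately show ?thesis by blast
qed

end
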